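(* Let $G_1$ and $G_2$ be any two groups (finite or infinite, abelian or non-abelian). Then all normal subgroups of $G_1 \times G_2$ are of standard type if and only if $G_1$ and $G_2$ satisfy the NS-condition.
   Context: A normal subgroup $N$ of $G_1 \times G_2$ is said to be of standard type if $N = N_1 \times N_2$ where $N_i$ is a normal subgroup of $G_i$ for $i=1,2$. Two groups $A$ and $B$ are said to have a subgroup in common if there exist non-trivial subgroups $A' \leq A$ and $B' \leq B$ such that $A' \cong B'$. Two groups $G_1$ and $G_2$ are said to satisfy the NS-condition if for all normal subgroups $H_1$ of $G_1$ and $H_2$ of $G_2$, the centres $Z(G_1/H_1)$ and $Z(G_2/H_2)$ of the quotient groups $G_1/H_1$ and $G_2/H_2$ have no subgroup in common. (Whether or not $H_i = G_i$ is allowed makes no difference, since then $Z(G_i/H_i)$ is trivial.) *)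

theory Defs
  imports "HOL-Algebra.Algebra"
begin

definition centre :: "('a, 'm) monoid_scheme \<Rightarrow> 'a set" where
  "centre G = {z \<in> carrier G. \<forall>g \<in> carrier G. z \<otimes>\<^bsub>G\<^esub> g = g \<otimes>\<^bsub>G\<^esub> z}"

definition standard_type ::
    "('a, 'm) monoid_scheme \<Rightarrow> ('b, 'n) monoid_scheme \<Rightarrow> ('a \<times> 'b) set \<Rightarrow> bool" where
  "standard_type G1 G2 N \<longleftrightarrow>
     (\<exists>N1 N2. N1 \<lhd> G1 \<and> N2 \<lhd> G2 \<and> N = N1 \<times> N2)"

definition have_subgroup_in_common ::
    "('a, 'm) monoid_scheme \<Rightarrow> ('b, 'n) monoid_scheme \<Rightarrow> bool" where
  "have_subgroup_in_common A B \<longleftrightarrow>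
     (\<exists>A' B'. subgroup A' A \<and> A' \<noteq> {\<one>\<^bsub>A\<^esub>} \<and> subgroup B' B \<and> B' \<noteq> {\<one>\<^bsub>B\<^esub>} \<and>
        A\<lparr>carrier := A'\<rparr> \<cong> B\<lparr>carrier := B'\<rparr>)"

definition NS_condition ::
    "('a, 'm) monoid_scheme \<Rightarrow> ('b, 'n) monoid_scheme \<Rightarrow> bool" where
  "NS_condition G1 G2 \<longleftrightarrow>
     (\<forall>H1 H2. H1 \<lhd> G1 \<longrightarrow> H2 \<lhd> G2 \<longrightarrow>
        \<not> have_subgroup_in_common
            ((G1 Mod H1)\<lparr>carrier := centre (G1 Mod H1)\<rparr>)
            ((G2 Mod H2)\<lparr>carrier := centre (G2 Mod H2)\<rparr>))"

end

theory Submission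
  imports Defs
begin

text \<open>
  The proof is Goursat's correspondence restricted to normal subgroups.

  Regard a normal subgroup \<open>N\<close> of \<open>G\<^sub>1 \<times> G\<^sub>2\<close> as a relation between the two factors, with domain
  \<open>P\<^sub>1\<close> and range \<open>P\<^sub>2\<close>, and let \<open>K\<^sub>1\<close>, \<open>K\<^sub>2\<close> be the elements related to the identity of the other
  factor. Modulo \<open>K\<^sub>1\<close> and \<open>K\<^sub>2\<close> the relation becomes the graph of an isomorphism
  \<open>P\<^sub>1/K\<^sub>1 \<cong> P\<^sub>2/K\<^sub>2\<close>. Normality makes both sides central: conjugating \<open>(x, y) \<in> N\<close> by
  \<open>(g, 1)\<close> changes only the first coordinate, so the commutator of \<open>g\<close> and \<open>x\<close> lies in \<open>K\<^sub>1\<close>, that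
  is, \<open>P\<^sub>1/K\<^sub>1 \<le> Z(G\<^sub>1/K\<^sub>1)\<close>. If \<open>P\<^sub>1/K\<^sub>1\<close> is trivial then \<open>N = K\<^sub>1 \<times> K\<^sub>2\<close>; so a normal subgroup that
  is not of standard type produces a common non-trivial subgroup of two centres.

  Conversely, an isomorphism \<open>f\<close> between non-trivial subgroups of \<open>Z(G\<^sub>1/H\<^sub>1)\<close> and \<open>Z(G\<^sub>2/H\<^sub>2)\<close> is
  pulled back to the set of all \<open>(x, y)\<close> with \<open>f (H\<^sub>1 x) = H\<^sub>2 y\<close>. Conjugation does not move central
  cosets, so this is a normal subgroup. It is not a product: it contains some \<open>(x, y)\<close> with
  \<open>H\<^sub>2 y \<noteq> H\<^sub>2\<close>, whereas \<open>(1, y)\<close> does not satisfy the equation.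
\<close>

lemma centre_subgroup:
  assumes "group G"
  shows "subgroup (centre G) G"
proof -
  interpret group G by fact
  show ?thesis
  proof (rule subgroupI)
    show "inv\<^bsub>G\<^esub> a \<in> centre G" if "a \<in> centre G" for a
    proof -
      have a: "a \<in> carrier G" and comm: "\<And>g. g \<in> carrier G \<Longrightarrow> a \<otimes>\<^bsub>G\<^esub> g = g \<otimes>\<^bsub>G\<^esub> a"
        using that by (auto simp: centre_def)
      have "inv\<^bsub>G\<^esub> a \<otimes>\<^bsub>G\<^esub> g = g \<otimes>\<^bsub>G\<^esub> inv\<^bsub>G\<^esub> a" if g: "g \<in> carrier G" for g
      proof -
        have "inv\<^bsub>G\<^esub> a \<otimes>\<^bsub>G\<^esub> g = inv\<^bsub>G\<^esub> (inv\<^bsub>G\<^esub> g \<otimes>\<^bsub>G\<^esub> a)"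
          using a g by (simp add: inv_mult_group)
        also have "\<dots> = inv\<^bsub>G\<^esub> (a \<otimes>\<^bsub>G\<^esub> inv\<^bsub>G\<^esub> g)"
          using a g comm by simp
        finally show ?thesis
          using a g by (simp add: inv_mult_group)
      qed
      then show ?thesis using a by (simp add: centre_def)
    qed
  next
    show "a \<otimes>\<^bsub>G\<^esub> b \<in> centre G" if "a \<in> centre G" "b \<in> centre G" for a b
    proof -
      have ab: "a \<in> carrier G" "b \<in> carrier G"
        and comm: "\<And>g. g \<in> carrier G \<Longrightarrow> a \<otimes>\<^bsub>G\<^esub> g = g \<otimes>\<^bsub>G\<^esub> a"
          "\<And>g. g \<in> carrier G \<Longrightarrow> b \<otimes>\<^bsub>G\<^esub> g = g \<otimes>\<^bsub>G\<^esub> b"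
        using that unfolding centre_def by blast+
      have "a \<otimes>\<^bsub>G\<^esub> b \<otimes>\<^bsub>G\<^esub> g = g \<otimes>\<^bsub>G\<^esub> (a \<otimes>\<^bsub>G\<^esub> b)" if "g \<in> carrier G" for g
        using ab that comm(1)[OF that] comm(2)[OF that] by (metis m_assoc)
      then show ?thesis using ab by (simp add: centre_def)
    qed
    show "centre G \<subseteq> carrier G" unfolding centre_def by blast
    have "\<one>\<^bsub>G\<^esub> \<in> centre G" by (simp add: centre_def)
    then show "centre G \<noteq> {}" by blast
  qed
qed

section \<open>Goursat's isomorphism for a normal subgroup\<close>

locale normal_DirProd =
  G1: group G1 + G2: group G2 + N: normal N "G1 \<times>\<times> G2"
  for G1 :: "('a, 'm) monoid_scheme" and G2 :: "('b, 'n) monoid_scheme" and N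
begin

text \<open>The kernel \<open>K\<^sub>1\<close> of the second projection on \<open>N\<close>, as a subset of the first factor. The kernel
  \<open>K\<^sub>2\<close> is the same construction for the swapped data \<open>G2\<close>, \<open>G1\<close>, \<open>N\<inverse>\<close>.\<close>

definition ker :: "'a set" where
  "ker = {x. (x, \<one>\<^bsub>G2\<^esub>) \<in> N}"

text \<open>The image of \<open>P\<^sub>1\<close> in \<open>G\<^sub>1/K\<^sub>1\<close>.\<close>

definition dom_cosets :: "'a set set" where
  "dom_cosets = (\<lambda>x. ker #>\<^bsub>G1\<^esub> x) ` Domain N"

lemma mem_carrier: "(x, y) \<in> N \<Longrightarrow> x \<in> carrier G1" "(x, y) \<in> N \<Longrightarrow> y \<in> carrier G2"
  using N.subset by auto

lemma one_mem: "(\<one>\<^bsub>G1\<^esub>, \<one>\<^bsub>G2\<^esub>) \<in> N"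
  using subgroup.one_closed[OF N.subgroup_axioms] by simp

lemma mult_mem: "(x, y) \<in> N \<Longrightarrow> (x', y') \<in> N \<Longrightarrow> (x \<otimes>\<^bsub>G1\<^esub> x', y \<otimes>\<^bsub>G2\<^esub> y') \<in> N"
  using subgroup.m_closed[OF N.subgroup_axioms, of "(x, y)" "(x', y')"] by simp

lemma inv_mem: "(x, y) \<in> N \<Longrightarrow> (inv\<^bsub>G1\<^esub> x, inv\<^bsub>G2\<^esub> y) \<in> N"
  using subgroup.m_inv_closed[OF N.subgroup_axioms, of "(x, y)"] mem_carrier[of x y]
  by (simp add: G1.is_group G2.is_group)

lemma conj_mem:
  assumes "(x, y) \<in> N" "g \<in> carrier G1" "h \<in> carrier G2"
  shows "(g \<otimes>\<^bsub>G1\<^esub> x \<otimes>\<^bsub>G1\<^esub> inv\<^bsub>G1\<^esub> g, h \<otimes>\<^bsub>G2\<^esub> y \<otimes>\<^bsub>G2\<^esub> inv\<^bsub>G2\<^esub> h) \<in> N"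
  using N.inv_op_closed2[of "(g, h)" "(x, y)"] assms by (simp add: G1.is_group G2.is_group)

lemma swap: "normal_DirProd G2 G1 (N\<inverse>)"
proof -
  interpret P: group "G2 \<times>\<times> G1"
    by (rule DirProd_group[OF G2.is_group G1.is_group])
  have "N\<inverse> \<lhd> G2 \<times>\<times> G1"
  proof (rule P.normal_invI)
    show "subgroup (N\<inverse>) (G2 \<times>\<times> G1)"
    proof (rule P.subgroupI)
      show "N\<inverse> \<subseteq> carrier (G2 \<times>\<times> G1)" using mem_carrier by auto
      show "N\<inverse> \<noteq> {}" using one_mem by blast
      show "inv\<^bsub>G2 \<times>\<times> G1\<^esub> a \<in> N\<inverse>" if "a \<in> N\<inverse>" for a
        using that inv_mem mem_carrier by (auto simp: G1.is_group G2.is_group)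
      show "a \<otimes>\<^bsub>G2 \<times>\<times> G1\<^esub> b \<in> N\<inverse>" if "a \<in> N\<inverse>" "b \<in> N\<inverse>" for a b
        using that mult_mem by auto
    qed
  qed (use conj_mem in \<open>auto simp: G1.is_group G2.is_group\<close>)
  then show ?thesis
    by (intro normal_DirProd.intro G1.is_group G2.is_group)
qed

lemma ker_normal: "ker \<lhd> G1"
proof (rule G1.normal_invI)
  show "subgroup ker G1"
  proof (rule G1.subgroupI)
    show "ker \<noteq> {}" using one_mem by (auto simp: ker_def)
    show "inv\<^bsub>G1\<^esub> a \<in> ker" if "a \<in> ker" for a
      using inv_mem[of a "\<one>\<^bsub>G2\<^esub>"] that by (simp add: ker_def)
    show "a \<otimes>\<^bsub>G1\<^esub> b \<in> ker" if "a \<in> ker" "b \<in> ker" for a b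
      using mult_mem[of a "\<one>\<^bsub>G2\<^esub>" b "\<one>\<^bsub>G2\<^esub>"] that by (simp add: ker_def)
    show "ker \<subseteq> carrier G1" unfolding ker_def using mem_carrier(1) by blast
  qed
  show "g \<otimes>\<^bsub>G1\<^esub> x \<otimes>\<^bsub>G1\<^esub> inv\<^bsub>G1\<^esub> g \<in> ker" if "g \<in> carrier G1" "x \<in> ker" for g x
    using conj_mem[of x "\<one>\<^bsub>G2\<^esub>" g "\<one>\<^bsub>G2\<^esub>"] that by (simp add: ker_def)
qed

lemma Domain_subgroup: "subgroup (Domain N) G1"
proof (rule G1.subgroupI)
  show "Domain N \<subseteq> carrier G1" using mem_carrier(1) by blast
  show "Domain N \<noteq> {}" using one_mem by blast
  show "inv\<^bsub>G1\<^esub> a \<in> Domain N" if "a \<in> Domain N" for a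
    using that inv_mem by blast
  show "a \<otimes>\<^bsub>G1\<^esub> b \<in> Domain N" if "a \<in> Domain N" "b \<in> Domain N" for a b
    using that mult_mem by blast
qed

lemma coset_hom: "group_hom G1 (G1 Mod ker) (\<lambda>x. ker #>\<^bsub>G1\<^esub> x)"
  using normal.factorgroup_is_group[OF ker_normal] normal.r_coset_hom_Mod[OF ker_normal]
  by (simp add: group_hom_def group_hom_axioms_def G1.is_group)

lemma dom_cosetsI: "(x, y) \<in> N \<Longrightarrow> ker #>\<^bsub>G1\<^esub> x \<in> dom_cosets"
  unfolding dom_cosets_def by blast

lemma dom_cosetsE:
  assumes "C \<in> dom_cosets"
  obtains x y where "(x, y) \<in> N" "C = ker #>\<^bsub>G1\<^esub> x"
  using assms unfolding dom_cosets_def by blast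

lemma dom_cosets_subgroup: "subgroup dom_cosets (G1 Mod ker)"
  unfolding dom_cosets_def
  by (rule group_hom.subgroup_img_is_subgroup[OF coset_hom Domain_subgroup])

text \<open>Conjugating \<open>(x, y)\<close> by \<open>(g, 1)\<close> stays in \<open>N\<close> and does not affect \<open>y\<close>. Multiplying the
  result by the inverse of \<open>(x, y)\<close> therefore cancels the second coordinate and leaves the
  commutator of \<open>g\<close> and \<open>x\<close> in the first.\<close>

lemma commutator_mem_ker:
  assumes xy: "(x, y) \<in> N" and g: "g \<in> carrier G1"
  shows "g \<otimes>\<^bsub>G1\<^esub> x \<otimes>\<^bsub>G1\<^esub> inv\<^bsub>G1\<^esub> g \<otimes>\<^bsub>G1\<^esub> inv\<^bsub>G1\<^esub> x \<in> ker"
  using mult_mem[OF conj_mem[OF xy g G2.one_closed] inv_mem[OF xy]] mem_carrier[OF xy]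
  by (simp add: ker_def)

lemma dom_cosets_central: "dom_cosets \<subseteq> centre (G1 Mod ker)"
proof
  fix C assume "C \<in> dom_cosets"
  then obtain x y where xy: "(x, y) \<in> N" and C: "C = ker #>\<^bsub>G1\<^esub> x"
    by (auto simp: dom_cosets_def)
  interpret K: normal ker G1 by (rule ker_normal)
  have x: "x \<in> carrier G1" using mem_carrier xy by blast
  have "(ker #>\<^bsub>G1\<^esub> x) <#>\<^bsub>G1\<^esub> (ker #>\<^bsub>G1\<^esub> g) = (ker #>\<^bsub>G1\<^esub> g) <#>\<^bsub>G1\<^esub> (ker #>\<^bsub>G1\<^esub> x)"
    if g: "g \<in> carrier G1" for g
  proof -
    have "g \<otimes>\<^bsub>G1\<^esub> x \<otimes>\<^bsub>G1\<^esub> inv\<^bsub>G1\<^esub> g \<otimes>\<^bsub>G1\<^esub> inv\<^bsub>G1\<^esub> x \<otimes>\<^bsub>G1\<^esub> (x \<otimes>\<^bsub>G1\<^esub> g) = g \<otimes>\<^bsub>G1\<^esub> x"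
      using g x by (metis G1.inv_closed G1.inv_solve_right G1.m_assoc G1.m_closed)
    then have "g \<otimes>\<^bsub>G1\<^esub> x \<in> ker #>\<^bsub>G1\<^esub> (x \<otimes>\<^bsub>G1\<^esub> g)"
      using G1.rcosI[OF commutator_mem_ker[OF xy g] K.subset, of "x \<otimes>\<^bsub>G1\<^esub> g"] g x by simp
    then have "ker #>\<^bsub>G1\<^esub> (x \<otimes>\<^bsub>G1\<^esub> g) = ker #>\<^bsub>G1\<^esub> (g \<otimes>\<^bsub>G1\<^esub> x)"
      using G1.repr_independence g x K.subgroup_axioms by simp
    then show ?thesis using g x by (simp add: K.rcos_sum)
  qed
  then show "C \<in> centre (G1 Mod ker)"
    using x by (auto simp: C centre_def carrier_FactGroup)
qed

text \<open>When all cosets of \<open>P\<^sub>1\<close> are trivial, the first coordinate of any \<open>(x, y) \<in> N\<close> can be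
  divided out inside \<open>N\<close>, leaving \<open>(1, y) \<in> N\<close>.\<close>

lemma standard_type_if_dom_cosets_trivial:
  assumes triv: "dom_cosets = {\<one>\<^bsub>G1 Mod ker\<^esub>}"
  shows "standard_type G1 G2 N"
proof -
  interpret S: normal_DirProd G2 G1 "N\<inverse>" by (rule swap)
  have fst_mem: "(x, \<one>\<^bsub>G2\<^esub>) \<in> N" if xy: "(x, y) \<in> N" for x y
  proof -
    have "ker #>\<^bsub>G1\<^esub> x \<in> dom_cosets" using xy by (auto simp: dom_cosets_def)
    then have "x \<in> ker"
      using triv G1.coset_join1 mem_carrier[OF xy] normal_imp_subgroup[OF ker_normal] by simp
    then show ?thesis by (simp add: ker_def)
  qed
  have snd_mem: "(\<one>\<^bsub>G1\<^esub>, y) \<in> N" if xy: "(x, y) \<in> N" for x y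
    using mult_mem[OF inv_mem[OF fst_mem[OF xy]] xy] mem_carrier[OF xy] by simp
  have "(x, y) \<in> N" if "(x, \<one>\<^bsub>G2\<^esub>) \<in> N" "(\<one>\<^bsub>G1\<^esub>, y) \<in> N" for x y
    using mult_mem[OF that] mem_carrier[OF that(1)] mem_carrier[OF that(2)] by simp
  then have "(x, y) \<in> N \<longleftrightarrow> (x, \<one>\<^bsub>G2\<^esub>) \<in> N \<and> (\<one>\<^bsub>G1\<^esub>, y) \<in> N" for x y
    using fst_mem snd_mem by blast
  then have "(x, y) \<in> N \<longleftrightarrow> x \<in> ker \<and> y \<in> S.ker" for x y
    unfolding ker_def S.ker_def mem_Collect_eq converse_iff .
  then have "N = ker \<times> S.ker"
    by auto
  then show ?thesis
    unfolding standard_type_def using ker_normal S.ker_normal by blast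
qed

text \<open>Goursat's isomorphism sends a coset to its image under the relation \<open>N\<close>, which avoids
  any choice of representatives: the partners of a single \<open>x\<close> already form a whole coset of
  \<open>K\<^sub>2\<close>, and multiplying \<open>x\<close> by elements of \<open>K\<^sub>1\<close> does not change them.\<close>

lemma Image_coset:
  assumes xy: "(x, y) \<in> N"
  shows "N `` (ker #>\<^bsub>G1\<^esub> x) = normal_DirProd.ker G1 (N\<inverse>) #>\<^bsub>G2\<^esub> y"
proof -
  interpret S: normal_DirProd G2 G1 "N\<inverse>" by (rule swap)
  note c = mem_carrier[OF xy]
  show ?thesis
  proof (intro equalityI subsetI)
    fix z assume "z \<in> N `` (ker #>\<^bsub>G1\<^esub> x)"
    then obtain k where k: "(k, \<one>\<^bsub>G2\<^esub>) \<in> N" and kz: "(k \<otimes>\<^bsub>G1\<^esub> x, z) \<in> N"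
      by (auto simp: r_coset_def ker_def)
    note k' = mem_carrier(1)[OF k] and z = mem_carrier(2)[OF kz]
    have "(k \<otimes>\<^bsub>G1\<^esub> x, y) \<in> N"
      using mult_mem[OF k xy] c by simp
    from mult_mem[OF kz inv_mem[OF this]] have "z \<otimes>\<^bsub>G2\<^esub> inv\<^bsub>G2\<^esub> y \<in> S.ker"
      using k' c by (simp add: S.ker_def)
    moreover have "z = z \<otimes>\<^bsub>G2\<^esub> inv\<^bsub>G2\<^esub> y \<otimes>\<^bsub>G2\<^esub> y"
      using z c by (simp add: G2.m_assoc)
    ultimately show "z \<in> S.ker #>\<^bsub>G2\<^esub> y"
      unfolding r_coset_def by blast
  next
    fix z assume "z \<in> S.ker #>\<^bsub>G2\<^esub> y"
    then obtain k where k: "(\<one>\<^bsub>G1\<^esub>, k) \<in> N" and z: "z = k \<otimes>\<^bsub>G2\<^esub> y"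
      by (auto simp: r_coset_def S.ker_def)
    have "(x, z) \<in> N"
      using mult_mem[OF k xy] c z by simp
    moreover have "x \<in> ker #>\<^bsub>G1\<^esub> x"
      using G1.rcos_self c normal_imp_subgroup[OF ker_normal] by blast
    ultimately show "z \<in> N `` (ker #>\<^bsub>G1\<^esub> x)" by blast
  qed
qed

lemma Goursat_iso:
  "(\<lambda>C. N `` C) \<in> iso ((G1 Mod ker)\<lparr>carrier := dom_cosets\<rparr>)
     ((G2 Mod normal_DirProd.ker G1 (N\<inverse>))\<lparr>carrier := normal_DirProd.dom_cosets G2 G1 (N\<inverse>)\<rparr>)"
proof -
  interpret S: normal_DirProd G2 G1 "N\<inverse>" by (rule swap)
  interpret K1: normal ker G1 by (rule ker_normal)
  interpret K2: normal S.ker G2 by (rule S.ker_normal)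
  have img: "N `` (ker #>\<^bsub>G1\<^esub> x) = S.ker #>\<^bsub>G2\<^esub> y" if "(x, y) \<in> N" for x y
    by (rule Image_coset[OF that])
  have img': "N\<inverse> `` (S.ker #>\<^bsub>G2\<^esub> y) = ker #>\<^bsub>G1\<^esub> x" if "(x, y) \<in> N" for x y
    using S.Image_coset[of y x] that by simp
  have maps: "N `` C \<in> S.dom_cosets" "N\<inverse> `` (N `` C) = C" if C: "C \<in> dom_cosets" for C
  proof -
    obtain x y where xy: "(x, y) \<in> N" "C = ker #>\<^bsub>G1\<^esub> x"
      using C by (rule dom_cosetsE)
    show "N `` C \<in> S.dom_cosets"
      using S.dom_cosetsI[of y x] xy(1) by (simp only: xy(2) img[OF xy(1)] converse_iff)
    show "N\<inverse> `` (N `` C) = C"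
      by (simp only: xy(2) img[OF xy(1)] img'[OF xy(1)])
  qed
  have maps': "N\<inverse> `` D \<in> dom_cosets" "N `` (N\<inverse> `` D) = D" if D: "D \<in> S.dom_cosets" for D
  proof -
    obtain y x where yx: "(y, x) \<in> N\<inverse>" "D = S.ker #>\<^bsub>G2\<^esub> y"
      using D by (rule S.dom_cosetsE)
    then have xy: "(x, y) \<in> N" by simp
    show "N\<inverse> `` D \<in> dom_cosets"
      using dom_cosetsI[OF xy] by (simp only: yx(2) img'[OF xy])
    show "N `` (N\<inverse> `` D) = D"
      by (simp only: yx(2) img[OF xy] img'[OF xy])
  qed
  show ?thesis
  proof (rule isoI)
    show "(\<lambda>C. N `` C) \<in> hom ((G1 Mod ker)\<lparr>carrier := dom_cosets\<rparr>)
        ((G2 Mod S.ker)\<lparr>carrier := S.dom_cosets\<rparr>)"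
    proof (rule homI)
      fix C D
      assume "C \<in> carrier ((G1 Mod ker)\<lparr>carrier := dom_cosets\<rparr>)"
        "D \<in> carrier ((G1 Mod ker)\<lparr>carrier := dom_cosets\<rparr>)"
      then obtain x y x' y' where xy: "(x, y) \<in> N" "(x', y') \<in> N"
        and CD: "C = ker #>\<^bsub>G1\<^esub> x" "D = ker #>\<^bsub>G1\<^esub> x'"
        by (auto elim!: dom_cosetsE)
      note c = mem_carrier[OF xy(1)] mem_carrier[OF xy(2)]
      show "N `` (C \<otimes>\<^bsub>(G1 Mod ker)\<lparr>carrier := dom_cosets\<rparr>\<^esub> D)
          = N `` C \<otimes>\<^bsub>(G2 Mod S.ker)\<lparr>carrier := S.dom_cosets\<rparr>\<^esub> N `` D"
        using c img[OF mult_mem[OF xy]]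
        by (simp add: CD img[OF xy(1)] img[OF xy(2)] K1.rcos_sum K2.rcos_sum)
    qed (simp add: maps(1))
    show "bij_betw (\<lambda>C. N `` C) (carrier ((G1 Mod ker)\<lparr>carrier := dom_cosets\<rparr>))
        (carrier ((G2 Mod S.ker)\<lparr>carrier := S.dom_cosets\<rparr>))"
      by (rule bij_betw_byWitness[where f' = "\<lambda>D. N\<inverse> `` D"])
        (simp_all add: maps maps' image_subset_iff)
  qed
qed

lemma not_NS_condition_if_not_standard_type:
  assumes nst: "\<not> standard_type G1 G2 N"
  shows "\<not> NS_condition G1 G2"
proof -
  interpret S: normal_DirProd G2 G1 "N\<inverse>" by (rule swap)
  interpret Q1: group "G1 Mod ker" by (rule normal.factorgroup_is_group[OF ker_normal])
  interpret Q2: group "G2 Mod S.ker" by (rule normal.factorgroup_is_group[OF S.ker_normal])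
  have nontriv: "dom_cosets \<noteq> {\<one>\<^bsub>G1 Mod ker\<^esub>}"
    using nst standard_type_if_dom_cosets_trivial by blast
  have nontriv': "S.dom_cosets \<noteq> {\<one>\<^bsub>G2 Mod S.ker\<^esub>}"
  proof
    assume "S.dom_cosets = {\<one>\<^bsub>G2 Mod S.ker\<^esub>}"
    then have "standard_type G2 G1 (N\<inverse>)"
      by (rule S.standard_type_if_dom_cosets_trivial)
    then obtain N2 N1 where "N2 \<lhd> G2" "N1 \<lhd> G1" "N\<inverse> = N2 \<times> N1"
      unfolding standard_type_def by blast
    moreover from this have "N = N1 \<times> N2" by auto
    ultimately show False using nst unfolding standard_type_def by blast
  qed
  have "have_subgroup_in_common
      ((G1 Mod ker)\<lparr>carrier := centre (G1 Mod ker)\<rparr>)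
      ((G2 Mod S.ker)\<lparr>carrier := centre (G2 Mod S.ker)\<rparr>)"
    unfolding have_subgroup_in_common_def
  proof (intro exI conjI)
    show "subgroup dom_cosets ((G1 Mod ker)\<lparr>carrier := centre (G1 Mod ker)\<rparr>)"
      by (intro Q1.subgroup_incl dom_cosets_subgroup dom_cosets_central
          centre_subgroup Q1.is_group)
    show "subgroup S.dom_cosets ((G2 Mod S.ker)\<lparr>carrier := centre (G2 Mod S.ker)\<rparr>)"
      by (intro Q2.subgroup_incl S.dom_cosets_subgroup S.dom_cosets_central
          centre_subgroup Q2.is_group)
  qed (use nontriv nontriv' is_isoI[OF Goursat_iso] in simp_all)
  then show ?thesis
    unfolding NS_condition_def using ker_normal S.ker_normal by blast
qed

end

section \<open>Pulling back an isomorphism between central subgroups\<close>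

lemma (in group_hom) hom_conj_central:
  assumes "h x \<in> centre H" "x \<in> carrier G" "g \<in> carrier G"
  shows "h (g \<otimes> x \<otimes> inv g) = h x"
proof -
  have "\<forall>b \<in> carrier H. h x \<otimes>\<^bsub>H\<^esub> b = b \<otimes>\<^bsub>H\<^esub> h x"
    using assms(1) unfolding centre_def by blast
  then have "h g \<otimes>\<^bsub>H\<^esub> h x = h x \<otimes>\<^bsub>H\<^esub> h g"
    using hom_closed[OF assms(3)] by metis
  then have "h (g \<otimes> x \<otimes> inv g) = h x \<otimes>\<^bsub>H\<^esub> h g \<otimes>\<^bsub>H\<^esub> inv\<^bsub>H\<^esub> h g"
    using assms(2,3) by simp
  also have "\<dots> = h x"
    using assms(2,3) by (simp add: H.m_assoc)
  finally show ?thesis .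
qed

text \<open>The pairs form a subgroup because both sides of the equation are multiplicative. Since
  \<open>p1 x\<close> and \<open>p2 y\<close> are central, conjugating \<open>(x, y)\<close> changes neither side.\<close>

lemma central_fibre_product_normal:
  assumes p1: "group_hom G1 Q1 p1" and p2: "group_hom G2 Q2 p2"
    and A: "subgroup A Q1" "A \<subseteq> centre Q1" and B: "subgroup B Q2" "B \<subseteq> centre Q2"
    and f: "f \<in> hom (Q1\<lparr>carrier := A\<rparr>) (Q2\<lparr>carrier := B\<rparr>)"
  shows "{(x, y). x \<in> carrier G1 \<and> y \<in> carrier G2 \<and> p1 x \<in> A \<and> f (p1 x) = p2 y} \<lhd> G1 \<times>\<times> G2"
    (is "?N \<lhd> _")
proof -
  interpret p1: group_hom G1 Q1 p1 by fact
  interpret p2: group_hom G2 Q2 p2 by fact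
  interpret A: subgroup A Q1 by fact
  interpret B: subgroup B Q2 by fact
  interpret P: group "G1 \<times>\<times> G2"
    by (rule DirProd_group[OF p1.G.is_group p2.G.is_group])
  interpret f: group_hom "Q1\<lparr>carrier := A\<rparr>" "Q2\<lparr>carrier := B\<rparr>" f
    using f A.subgroup_is_group[OF p1.H.is_group] B.subgroup_is_group[OF p2.H.is_group]
    by (simp add: group_hom_def group_hom_axioms_def)
  have f_mult: "f (a \<otimes>\<^bsub>Q1\<^esub> b) = f a \<otimes>\<^bsub>Q2\<^esub> f b" if "a \<in> A" "b \<in> A" for a b
    using f.hom_mult that by simp
  have f_one: "f \<one>\<^bsub>Q1\<^esub> = \<one>\<^bsub>Q2\<^esub>"
    using f.hom_one by simp
  have f_mem: "f a \<in> B" if "a \<in> A" for a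
    using f.hom_closed that by simp
  have f_inv: "f (inv\<^bsub>Q1\<^esub> a) = inv\<^bsub>Q2\<^esub> (f a)" if "a \<in> A" for a
    using f.hom_inv[of a] that f_mem[OF that] A(1) B(1) by simp
  show ?thesis
  proof (rule P.normal_invI)
    show "subgroup ?N (G1 \<times>\<times> G2)"
    proof (rule P.subgroupI)
      have "(\<one>\<^bsub>G1\<^esub>, \<one>\<^bsub>G2\<^esub>) \<in> ?N" by (simp add: f_one)
      then show "?N \<noteq> {}" by blast
    qed (auto simp: p1.G.is_group p2.G.is_group f_mult f_inv)
  next
    fix u v assume u: "u \<in> carrier (G1 \<times>\<times> G2)" and v: "v \<in> ?N"
    obtain g h where gh: "u = (g, h)" "g \<in> carrier G1" "h \<in> carrier G2"
      using u by auto
    obtain x y where xy: "v = (x, y)" "x \<in> carrier G1" "y \<in> carrier G2" "p1 x \<in> A"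
        "f (p1 x) = p2 y"
      using v by auto
    have "p1 x \<in> centre Q1" "p2 y \<in> centre Q2"
      using xy f_mem[OF xy(4)] A(2) B(2) by auto
    then have "p1 (g \<otimes>\<^bsub>G1\<^esub> x \<otimes>\<^bsub>G1\<^esub> inv\<^bsub>G1\<^esub> g) = p1 x" "p2 (h \<otimes>\<^bsub>G2\<^esub> y \<otimes>\<^bsub>G2\<^esub> inv\<^bsub>G2\<^esub> h) = p2 y"
      using gh xy p1.hom_conj_central p2.hom_conj_central by blast+
    then show "u \<otimes>\<^bsub>G1 \<times>\<times> G2\<^esub> v \<otimes>\<^bsub>G1 \<times>\<times> G2\<^esub> inv\<^bsub>G1 \<times>\<times> G2\<^esub> u \<in> ?N"
      using gh xy by (simp add: p1.G.is_group p2.G.is_group del: p1.hom_mult p2.hom_mult)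
  qed
qed

lemma not_standard_type_if_common_central_subgroup:
  fixes G1 :: "('a, 'm) monoid_scheme" and G2 :: "('b, 'n) monoid_scheme"
  assumes H: "H1 \<lhd> G1" "H2 \<lhd> G2"
    and common: "have_subgroup_in_common
            ((G1 Mod H1)\<lparr>carrier := centre (G1 Mod H1)\<rparr>)
            ((G2 Mod H2)\<lparr>carrier := centre (G2 Mod H2)\<rparr>)"
  shows "\<exists>N. N \<lhd> (G1 \<times>\<times> G2) \<and> \<not> standard_type G1 G2 N"
proof -
  interpret H1: normal H1 G1 by fact
  interpret H2: normal H2 G2 by fact
  interpret Q1: group "G1 Mod H1" by (rule H1.factorgroup_is_group)
  interpret Q2: group "G2 Mod H2" by (rule H2.factorgroup_is_group)
  obtain A B f where
      A: "subgroup A ((G1 Mod H1)\<lparr>carrier := centre (G1 Mod H1)\<rparr>)" "A \<noteq> {H1}"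
    and B: "subgroup B ((G2 Mod H2)\<lparr>carrier := centre (G2 Mod H2)\<rparr>)"
    and f: "f \<in> iso ((G1 Mod H1)\<lparr>carrier := A\<rparr>) ((G2 Mod H2)\<lparr>carrier := B\<rparr>)"
    using common unfolding have_subgroup_in_common_def is_iso_def by auto
  have A_sub: "subgroup A (G1 Mod H1)" "A \<subseteq> centre (G1 Mod H1)"
    using Q1.incl_subgroup[OF centre_subgroup A(1)] subgroup.subset[OF A(1)]
    by (simp_all add: Q1.is_group)
  have B_sub: "subgroup B (G2 Mod H2)" "B \<subseteq> centre (G2 Mod H2)"
    using Q2.incl_subgroup[OF centre_subgroup B] subgroup.subset[OF B]
    by (simp_all add: Q2.is_group)
  have f_hom: "f \<in> hom ((G1 Mod H1)\<lparr>carrier := A\<rparr>) ((G2 Mod H2)\<lparr>carrier := B\<rparr>)"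
    and f_inj: "inj_on f A" and f_mem: "\<And>a. a \<in> A \<Longrightarrow> f a \<in> B"
    using f by (auto simp: iso_def bij_betw_def)
  interpret f: group_hom "(G1 Mod H1)\<lparr>carrier := A\<rparr>" "(G2 Mod H2)\<lparr>carrier := B\<rparr>" f
    using f_hom subgroup.subgroup_is_group[OF A_sub(1) Q1.is_group]
      subgroup.subgroup_is_group[OF B_sub(1) Q2.is_group]
    by (simp add: group_hom_def group_hom_axioms_def)
  have f_one: "f H1 = H2" using f.hom_one by simp
  have H1_mem: "H1 \<in> A" using subgroup.one_closed[OF A_sub(1)] by simp
  define N where "N = {(x, y). x \<in> carrier G1 \<and> y \<in> carrier G2 \<and>
      H1 #>\<^bsub>G1\<^esub> x \<in> A \<and> f (H1 #>\<^bsub>G1\<^esub> x) = H2 #>\<^bsub>G2\<^esub> y}"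
  have "group_hom G1 (G1 Mod H1) (\<lambda>x. H1 #>\<^bsub>G1\<^esub> x)" "group_hom G2 (G2 Mod H2) (\<lambda>y. H2 #>\<^bsub>G2\<^esub> y)"
    using H1.r_coset_hom_Mod H2.r_coset_hom_Mod
    by (simp_all add: group_hom_def group_hom_axioms_def
        H1.is_group H2.is_group Q1.is_group Q2.is_group)
  then have normal: "N \<lhd> G1 \<times>\<times> G2"
    unfolding N_def by (rule central_fibre_product_normal[OF _ _ A_sub B_sub f_hom])
  obtain a where a: "a \<in> A" "a \<noteq> H1"
    using A(2) H1_mem by blast
  then obtain x where x: "x \<in> carrier G1" "a = H1 #>\<^bsub>G1\<^esub> x"
    using subgroup.subset[OF A_sub(1)] by (auto simp: carrier_FactGroup)
  have "f a \<in> carrier (G2 Mod H2)"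
    using f_mem[OF a(1)] subgroup.subset[OF B_sub(1)] by blast
  then obtain y where y: "y \<in> carrier G2" "f a = H2 #>\<^bsub>G2\<^esub> y"
    by (auto simp: carrier_FactGroup)
  have "f a \<noteq> H2"
    using f_inj a H1_mem f_one by (metis inj_onD)
  have "\<not> standard_type G1 G2 N"
  proof
    assume "standard_type G1 G2 N"
    then obtain N1 N2 where NN: "N = N1 \<times> N2" unfolding standard_type_def by blast
    have xy: "(x, y) \<in> N" using a x y by (simp add: N_def)
    have one: "(\<one>\<^bsub>G1\<^esub>, \<one>\<^bsub>G2\<^esub>) \<in> N"
      using subgroup.one_closed[OF normal_imp_subgroup[OF normal]] by simp
    have "(\<one>\<^bsub>G1\<^esub>, y) \<in> N" using xy one NN by auto
    then have "f H1 = H2 #>\<^bsub>G2\<^esub> y"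
      by (simp add: N_def H1.coset_mult_one[OF H1.subset])
    then show False using \<open>f a \<noteq> H2\<close> y f_one by simp
  qed
  then show ?thesis using normal by blast
qed

section \<open>The characterisation\<close>

theorem theorem3p1:
  fixes G1 :: "('a, 'm) monoid_scheme" and G2 :: "('b, 'n) monoid_scheme"
  assumes "group G1" and "group G2"
  shows "(\<forall>N. N \<lhd> (G1 \<times>\<times> G2) \<longrightarrow> standard_type G1 G2 N) \<longleftrightarrow> NS_condition G1 G2"
proof
  assume "\<forall>N. N \<lhd> (G1 \<times>\<times> G2) \<longrightarrow> standard_type G1 G2 N"
  then show "NS_condition G1 G2"
    unfolding NS_condition_def using not_standard_type_if_common_central_subgroup by blast
next
  assume "NS_condition G1 G2"
  then show "\<forall>N. N \<lhd> (G1 \<times>\<times> G2) \<longrightarrow> standard_type G1 G2 N"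
    using normal_DirProd.not_NS_condition_if_not_standard_type normal_DirProd.intro assms
    by blast
qed

end
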